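(* Let $X,Y\subseteq\mathbb{N}$, let $\rho=(\rho_1,\dots,\rho_m)$ be a composition of $n$, and let $s\ge0$. Write $[m]\setminus X=\{v_1,\dots,v_b\}$ and $a=\sum_{i=1}^b\rho_{v_i}$. Then $$P_{\rho,s}^{X,Y}=\binom{a}{\rho_{v_1},\dots,\rho_{v_b}}\sum_{r=0}^{s}(-1)^{s-r}\binom{a+r}{r}\binom{n+1}{s-r}\prod_{x\in X\cap[m]}\binom{\rho_x+r+\alpha_{X,\rho,x}+\beta_{Y,\rho,x}}{\rho_x}.$$
   Context: A composition $\rho=(\rho_1,\dots,\rho_m)$ of $n$ has positive integer parts summing to $n$. $R(\rho)$ is the set of all words $w=w_1\cdots w_n$ that are rearrangements of $1^{\rho_1}2^{\rho_2}\cdots m^{\rho_m}$ ($\rho_i$ copies of $i$). For $X,Y\subseteq\mathbb{N}$, $des_{X,Y}(w)=|\{i:w_i>w_{i+1},\ w_i\in X,\ w_{i+1}\in Y\}|$ and $P_{\rho,s}^{X,Y}=|\{w\in R(\rho):des_{X,Y}(w)=s\}|$. For $x\in[m]$: $\alpha_{X,\rho,x}=\sum_{z\notin X,\ x<z\le m}\rho_z$ and $\beta_{Y,\rho,x}=\sum_{z\notin Y,\ 1\le z<x}\rho_z$. $\binom{a}{\rho_{v_1},\dots,\rho_{v_b}}$ is a multinomial coefficient. *)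

theory Defs
  imports "HOL-Combinatorics.Multiset_Permutations"
begin

definition composition :: "nat \<Rightarrow> nat list \<Rightarrow> bool" where
  "composition n \<rho> \<longleftrightarrow> (\<forall>p \<in> set \<rho>. 0 < p) \<and> sum_list \<rho> = n"

text \<open>Parts are numbered from 1 as in the mathematics, list positions from 0; only
  \<open>part \<rho> i\<close> with \<open>1 \<le> i \<le> length \<rho>\<close> is meaningful.\<close>

definition part :: "nat list \<Rightarrow> nat \<Rightarrow> nat" where
  "part \<rho> i = \<rho> ! (i - 1)"

definition words :: "nat list \<Rightarrow> nat list set" where
  "words \<rho> = permutations_of_multiset (\<Sum>i = 1..length \<rho>. replicate_mset (part \<rho> i) i)"

definition des :: "nat set \<Rightarrow> nat set \<Rightarrow> nat list \<Rightarrow> nat" where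
  "des X Y w = card {i. Suc i < length w \<and> w ! i > w ! Suc i \<and> w ! i \<in> X \<and> w ! Suc i \<in> Y}"

definition P :: "nat set \<Rightarrow> nat set \<Rightarrow> nat list \<Rightarrow> nat \<Rightarrow> nat" where
  "P X Y \<rho> s = card {w \<in> words \<rho>. des X Y w = s}"

definition \<alpha> :: "nat set \<Rightarrow> nat list \<Rightarrow> nat \<Rightarrow> nat" where
  "\<alpha> X \<rho> x = (\<Sum>z \<in> {z. z \<notin> X \<and> x < z \<and> z \<le> length \<rho>}. part \<rho> z)"

definition \<beta> :: "nat set \<Rightarrow> nat list \<Rightarrow> nat \<Rightarrow> nat" where
  "\<beta> Y \<rho> x = (\<Sum>z \<in> {z. z \<notin> Y \<and> 1 \<le> z \<and> z < x}. part \<rho> z)"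

text \<open>The multinomial coefficient with upper entry \<open>a\<close> and lower entries \<open>k v\<close> for
  \<open>v\<close> in the finite set \<open>V\<close>. The division is exact when \<open>a\<close> is the sum of the lower entries,
  which is the only case in which it is used.\<close>

definition multinomial :: "nat \<Rightarrow> ('a \<Rightarrow> nat) \<Rightarrow> 'a set \<Rightarrow> nat" where
  "multinomial a k V = fact a div (\<Prod>v \<in> V. fact (k v))"

end

theory Submission
  imports Defs "HOL-Computational_Algebra.Formal_Power_Series"
begin

text \<open>
  Put \<open>r\<close> bars into the \<open>n + 1\<close> gaps of a word, several bars being allowed in one gap, so that
  every counted descent carries a bar; a word with \<open>d\<close> counted descents admits
  \<open>(n + r - d) choose n\<close> such barrings. As the letter \<open>0\<close> is removed from \<open>Y\<close>, a bar can be
  encoded as an additional letter \<open>0\<close>, and a barred word is a word without counted descents.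

  Words without counted descents are built by inserting the letters of \<open>X\<close> in increasing order
  into an arbitrary word on the remaining letters. A new letter \<open>x\<close>, larger than all letters of
  \<open>X\<close> inserted before, may be placed only at the end, before another \<open>x\<close>, or before a letter
  that is not in \<open>Y\<close> or exceeds \<open>x\<close>. The number of admissible places does not depend on the
  word, which gives the product over \<open>X\<close>. The alternating sum inverts the relation between
  barred words and words with a given number of descents: it expresses
  \<open>(1 - t)^(n+1) * (1 - t)^(-(n+1)) = 1\<close> in terms of coefficients.
\<close>

section \<open>Inserting copies of one letter into a word\<close>

definition followed_by :: "'a \<Rightarrow> ('a \<Rightarrow> bool) \<Rightarrow> 'a list \<Rightarrow> bool" where
  "followed_by x Q = successively (\<lambda>p c. p = x \<longrightarrow> c = x \<or> Q c)"

lemma followed_by_simps [simp]: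
  "followed_by x Q []" "followed_by x Q [p]"
  "followed_by x Q (p # c # u) \<longleftrightarrow> (p = x \<longrightarrow> c = x \<or> Q c) \<and> followed_by x Q (c # u)"
  by (simp_all add: followed_by_def)

lemma followed_by_Cons_other: "p \<noteq> x \<Longrightarrow> followed_by x Q (p # u) \<longleftrightarrow> followed_by x Q u"
  by (cases u) auto

text \<open>Only copies of \<open>x\<close> stand between the leading \<open>x\<close> and
  \<open>c\<close>, so the last copy of this run has \<open>c\<close> as its successor.\<close>

lemma followed_by_first_other:
  assumes "followed_by x Q (x # u)" "filter (\<lambda>y. y \<noteq> x) u = c # w"
  shows "Q c"
  using assms by (induction u) (auto split: if_splits)

text \<open>A run of \<open>x\<close> has to stop before a letter satisfying \<open>Q\<close> or at
  the end of the word, where \<open>followed_by\<close> imposes nothing.\<close>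

definition insertions :: "'a \<Rightarrow> ('a \<Rightarrow> bool) \<Rightarrow> 'a list \<Rightarrow> nat \<Rightarrow> 'a list set" where
  "insertions x Q w k =
    {u. filter (\<lambda>y. y \<noteq> x) u = w \<and> count_list u x = k \<and> followed_by x Q u}"

lemma followed_by_replicate: "followed_by x Q (replicate k x)"
proof (induction k)
  case (Suc k)
  then show ?case by (cases k) auto
qed simp

lemma insertions_Nil: "insertions x Q [] k = {replicate k x}"
proof -
  have "u = replicate k x" if "filter (\<lambda>y. y \<noteq> x) u = []" "count_list u x = k" for u
    using that by (induction u arbitrary: k) (auto split: if_splits)
  moreover have "count_list (replicate k x) x = k"
    by (induction k) auto
  ultimately show ?thesis
    by (auto simp: insertions_def followed_by_replicate)
qed

text \<open>Split by the first letter of the result. It is \<open>c\<close>, or it is an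
  \<open>x\<close> that can be deleted; in the second case the initial run of \<open>x\<close> stops
  before \<open>c\<close>, which forces \<open>Q c\<close>.\<close>

lemma insertions_Cons:
  assumes "c \<noteq> x"
  shows "insertions x Q (c # w) k =
    Cons c ` insertions x Q w k \<union>
    (if k > 0 \<and> Q c then Cons x ` insertions x Q (c # w) (k - 1) else {})"
    (is "?L = ?R")
proof (intro set_eqI iffI)
  fix u assume u: "u \<in> ?L"
  then obtain p v where uv: "u = p # v"
    by (cases u) (auto simp: insertions_def)
  show "u \<in> ?R"
  proof (cases "p = x")
    case True
    then have f: "filter (\<lambda>y. y \<noteq> x) v = c # w" and fb: "followed_by x Q (x # v)"
      using u uv by (auto simp: insertions_def)
    from fb f have "Q c" by (rule followed_by_first_other)
    moreover have "followed_by x Q v"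
      using u uv by (cases v) (auto simp: insertions_def)
    ultimately show ?thesis using u uv True f
      by (auto simp: insertions_def)
  next
    case False
    then show ?thesis using u uv
      by (auto simp: insertions_def followed_by_Cons_other)
  qed
next
  fix u assume u: "u \<in> ?R"
  show "u \<in> ?L"
  proof (cases "u \<in> Cons c ` insertions x Q w k")
    case True
    then show ?thesis using assms
      by (auto simp: insertions_def followed_by_Cons_other)
  next
    case False
    then obtain v where v: "u = x # v" "k > 0" "Q c" "v \<in> insertions x Q (c # w) (k - 1)"
      using u by (auto split: if_splits)
    \<comment> \<open>Whichever letter starts \<open>v\<close>, a further \<open>x\<close> may
      precede it: another \<open>x\<close> always allows this, and \<open>c\<close> does because of
      \<open>Q c\<close>.\<close>
    then obtain d v' where "v = d # v'" "d = x \<or> d = c"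
      by (cases v) (auto simp: insertions_def split: if_splits)
    then show ?thesis using v by (auto simp: insertions_def)
  qed
qed

text \<open>The admissible places are the end of \<open>w\<close> and the gaps before its letters
  satisfying \<open>Q\<close>; \<open>k\<close> indistinguishable copies are distributed over them
  with repetition. In the induction, \<open>insertions_Cons\<close> becomes Pascal's rule if
  \<open>Q c\<close>; the inner induction on \<open>k\<close> serves the summand that keeps the word
  \<open>c # w\<close>.\<close>

lemma card_insertions:
  assumes "x \<notin> set w"
  shows "finite (insertions x Q w k) \<and>
    card (insertions x Q w k) = (k + length (filter Q w)) choose k"
  using assms
proof (induction w arbitrary: k)
  case Nil
  then show ?case by (simp add: insertions_Nil)
next
  case (Cons c w)
  then have cx: "c \<noteq> x" and "x \<notin> set w" by auto
  note IH = Cons.IH[OF \<open>x \<notin> set w\<close>]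
  show ?case
  proof (induction k)
    case 0
    show ?case using IH[of 0] insertions_Cons[OF cx, of Q w 0]
      by (simp add: card_image)
  next
    case (Suc k)
    have disj: "Cons c ` A \<inter> Cons x ` B = {}" for A B using cx by auto
    show ?case
    proof (cases "Q c")
      case True
      have eq: "insertions x Q (c # w) (Suc k) =
          Cons c ` insertions x Q w (Suc k) \<union> Cons x ` insertions x Q (c # w) k"
        using insertions_Cons[OF cx, of Q w "Suc k"] True by simp
      have "card (insertions x Q (c # w) (Suc k)) =
          card (insertions x Q w (Suc k)) + card (insertions x Q (c # w) k)"
        unfolding eq using Suc IH[of "Suc k"]
        by (subst card_Un_disjoint) (auto simp: disj card_image)
      moreover have "finite (insertions x Q (c # w) (Suc k))"
        unfolding eq using Suc IH[of "Suc k"] by blast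
      ultimately show ?thesis
        using Suc IH[of "Suc k"] True by simp
    next
      case False
      then show ?thesis
        using insertions_Cons[OF cx, of Q w "Suc k"] IH[of "Suc k"] by (simp add: card_image)
    qed
  qed
qed

section \<open>Counting words without counted descents\<close>

lemma card_eq_sum_fibres:
  assumes "finite A" "finite B" "\<And>u. u \<in> A \<Longrightarrow> f u \<in> B"
  shows "card A = (\<Sum>b\<in>B. card {u \<in> A. f u = b})"
  using sum.group[of A B f "\<lambda>_. 1 :: nat"] assms by (auto simp: image_subset_iff)

definition descent_free :: "'a::linorder set \<Rightarrow> 'a set \<Rightarrow> 'a list \<Rightarrow> bool" where
  "descent_free X Y = successively (\<lambda>p c. \<not> (c < p \<and> p \<in> X \<and> c \<in> Y))"

lemma descent_free_simps [simp]:
  "descent_free X Y []" "descent_free X Y [p]"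
  "descent_free X Y (p # c # u) \<longleftrightarrow> \<not> (c < p \<and> p \<in> X \<and> c \<in> Y) \<and> descent_free X Y (c # u)"
  by (auto simp: descent_free_def)

lemma descent_free_ConsD: "descent_free X Y (p # u) \<Longrightarrow> descent_free X Y u"
  by (cases u) auto

lemma descent_free_Cons:
  "descent_free X Y (p # u) \<longleftrightarrow>
    descent_free X Y u \<and> (u \<noteq> [] \<longrightarrow> \<not> (hd u < p \<and> p \<in> X \<and> hd u \<in> Y))"
  by (cases u) auto

text \<open>A step from a letter of \<open>X\<close> to \<open>x\<close> is an ascent, so copies of
  \<open>x\<close> restrict only their own successors. Deleting a run of \<open>x\<close> between
  \<open>p\<close> in \<open>X\<close> and a letter \<open>d\<close> creates no counted descent:
  \<open>d\<close> is outside \<open>Y\<close> or satisfies \<open>p < x < d\<close>.\<close>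

lemma descent_free_insert_max_iff:
  fixes X :: "'a::linorder set"
  assumes "\<And>y. y \<in> X \<Longrightarrow> y < x"
  shows "descent_free (insert x X) Y u \<longleftrightarrow>
    descent_free X Y (filter (\<lambda>y. y \<noteq> x) u) \<and> followed_by x (\<lambda>c. c \<notin> Y \<or> x < c) u"
proof (induction u)
  case Nil
  show ?case by simp
next
  case (Cons p u)
  let ?Q = "\<lambda>c. c \<notin> Y \<or> x < c"
  show ?case
  proof (cases u)
    case Nil
    then show ?thesis by simp
  next
    case u: (Cons c v)
    show ?thesis
    proof (cases "p = x")
      case True
      then show ?thesis using Cons.IH u by (auto simp: not_less)
    next
      case px: False
      have fb: "followed_by x ?Q (p # u) \<longleftrightarrow> followed_by x ?Q u"
        using px by (simp add: followed_by_Cons_other)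
      show ?thesis
      proof (cases "c = x")
        case True
        have "\<not> (hd (filter (\<lambda>y. y \<noteq> x) u) < p \<and> p \<in> X \<and> hd (filter (\<lambda>y. y \<noteq> x) u) \<in> Y)"
          if fq: "followed_by x ?Q u" and ne: "filter (\<lambda>y. y \<noteq> x) u \<noteq> []"
        proof -
          obtain d w where dw: "filter (\<lambda>y. y \<noteq> x) v = d # w"
            using ne u True by (cases "filter (\<lambda>y. y \<noteq> x) v") auto
          then have "?Q d"
            using fq u True by (intro followed_by_first_other[where Q = ?Q, OF _ dw]) simp
          then show ?thesis using dw u True assms[of p] by auto
        qed
        moreover have "\<not> (c < p \<and> p \<in> insert x X \<and> c \<in> Y)"
          using True px assms[of p] by auto
        ultimately show ?thesis
          using Cons.IH u px fb by (auto simp: descent_free_Cons[of X Y p])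
      next
        case False
        then show ?thesis using Cons.IH u px fb by auto
      qed
    qed
  qed
qed

definition descent_free_perms :: "'a::linorder set \<Rightarrow> 'a set \<Rightarrow> 'a multiset \<Rightarrow> 'a list set" where
  "descent_free_perms X Y M = {u \<in> permutations_of_multiset M. descent_free X Y u}"

lemma descent_free_empty [simp]: "descent_free {} Y u"
  by (induction u) (auto simp: descent_free_Cons)

lemma count_list_eq_count: "count_list u x = count (mset u) x"
  by (induction u) auto

text \<open>Group the words by what remains after deleting \<open>x\<close>. The fibre over
  \<open>w\<close> is a set of insertions, whose size depends only on the multiset of letters of
  \<open>w\<close>, so all fibres have the same size.\<close>

lemma card_descent_free_perms_insert_max:
  fixes X :: "'a::linorder set"
  assumes X: "\<And>y. y \<in> X \<Longrightarrow> y < x"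
  shows "card (descent_free_perms (insert x X) Y M) =
    card (descent_free_perms X Y (filter_mset (\<lambda>y. y \<noteq> x) M)) *
    ((count M x + size (filter_mset (\<lambda>z. z \<noteq> x \<and> (z \<notin> Y \<or> x < z)) M)) choose count M x)"
proof -
  let ?f = "filter (\<lambda>y. y \<noteq> x)" and ?M = "filter_mset (\<lambda>y. y \<noteq> x) M"
    and ?Q = "\<lambda>c. c \<notin> Y \<or> x < c"
  let ?A = "descent_free_perms (insert x X) Y M" and ?B = "descent_free_perms X Y ?M"
  have M: "mset u = M \<longleftrightarrow> filter_mset (\<lambda>y. y \<noteq> x) (mset u) = ?M \<and> count (mset u) x = count M x" for u
    by (auto simp: multiset_eq_iff)
  have A: "u \<in> ?A \<longleftrightarrow> ?f u \<in> ?B \<and> count_list u x = count M x \<and> followed_by x ?Q u" for u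
    using M[of u] descent_free_insert_max_iff[OF X, where u = u and Y = Y]
    by (auto simp: descent_free_perms_def permutations_of_multiset_def count_list_eq_count)
  have fin: "finite ?A" "finite ?B"
    by (simp_all add: descent_free_perms_def)
  have "card ?A = (\<Sum>w\<in>?B. card {u \<in> ?A. ?f u = w})"
    using A by (intro card_eq_sum_fibres fin) auto
  also have "\<dots> = (\<Sum>w\<in>?B. (count M x + size (filter_mset (\<lambda>z. z \<noteq> x \<and> ?Q z) M)) choose count M x)"
  proof (intro sum.cong refl)
    fix w assume w: "w \<in> ?B"
    then have mw: "mset w = ?M"
      by (auto simp: descent_free_perms_def permutations_of_multiset_def)
    have "{u \<in> ?A. ?f u = w} = insertions x ?Q w (count M x)"
      using A w by (auto simp: insertions_def)
    moreover have "x \<notin> set w"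
      using mw by (metis (mono_tags, lifting) mem_Collect_eq set_mset_filter set_mset_mset)
    moreover have "length (filter ?Q w) = size (filter_mset (\<lambda>z. z \<noteq> x \<and> ?Q z) M)"
      by (metis filter_filter_mset mset_filter mw size_mset)
    ultimately show "card {u \<in> ?A. ?f u = w} =
        (count M x + size (filter_mset (\<lambda>z. z \<noteq> x \<and> ?Q z) M)) choose count M x"
      using card_insertions[of x w ?Q "count M x"] by simp
  qed
  finally show ?thesis by simp
qed

text \<open>The largest letter of \<open>X\<close> is split off first, so each letter of
  \<open>X\<close> is inserted when only the smaller ones and the letters outside \<open>X\<close>
  are present. What remains at the end is an unrestricted arrangement of the letters outside
  \<open>X\<close>.\<close>

lemma card_descent_free_perms:
  fixes X :: "'a::linorder set"
  assumes "finite X"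
  shows "card (descent_free_perms X Y M) =
    card (permutations_of_multiset (filter_mset (\<lambda>z. z \<notin> X) M)) *
    (\<Prod>x\<in>X. (count M x + size (filter_mset (\<lambda>z. z \<notin> X \<and> x < z) M) +
        size (filter_mset (\<lambda>z. z \<notin> Y \<and> z < x) M)) choose count M x)"
  using assms
proof (induction X arbitrary: M rule: finite_linorder_max_induct)
  case empty
  show ?case by (simp add: descent_free_perms_def)
next
  case (insert x X)
  let ?M = "filter_mset (\<lambda>y. y \<noteq> x) M"
  have xX: "x \<notin> X" using insert.hyps by auto
  \<comment> \<open>The places split into those before letters above and below \<open>x\<close>.
    Every letter above \<open>x\<close> is automatically outside \<open>insert x X\<close>, as
    \<open>x\<close> exceeds all of \<open>X\<close>.\<close>
  have "size (filter_mset (\<lambda>z. z \<noteq> x \<and> (z \<notin> Y \<or> x < z)) M) =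
      size (filter_mset (\<lambda>z. z \<notin> insert x X \<and> x < z) M) + size (filter_mset (\<lambda>z. z \<notin> Y \<and> z < x) M)"
    unfolding size_union[symmetric]
    using insert.hyps by (intro arg_cong[of _ _ size]) (auto simp: multiset_eq_iff)
  then have *: "card (descent_free_perms (insert x X) Y M) = card (descent_free_perms X Y ?M) *
    ((count M x + size (filter_mset (\<lambda>z. z \<notin> insert x X \<and> x < z) M) +
        size (filter_mset (\<lambda>z. z \<notin> Y \<and> z < x) M)) choose count M x)"
    using insert.hyps by (subst card_descent_free_perms_insert_max) (auto simp: add.assoc)
  have "(\<Prod>y\<in>X. (count ?M y + size (filter_mset (\<lambda>z. z \<notin> X \<and> y < z) ?M) +
        size (filter_mset (\<lambda>z. z \<notin> Y \<and> z < y) ?M)) choose count ?M y) =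
     (\<Prod>y\<in>X. (count M y + size (filter_mset (\<lambda>z. z \<notin> insert x X \<and> y < z) M) +
        size (filter_mset (\<lambda>z. z \<notin> Y \<and> z < y) M)) choose count M y)"
  proof (intro prod.cong refl)
    fix y assume "y \<in> X"
    then have "y < x" using insert.hyps by auto
    \<comment> \<open>Removing \<open>x\<close> from \<open>M\<close> has the same effect on the
      first filter as adding it to \<open>X\<close>; the second filter never sees \<open>x\<close>,
      because \<open>y < x\<close>.\<close>
    then have eq: "filter_mset (\<lambda>z. z \<notin> X \<and> y < z) ?M = filter_mset (\<lambda>z. z \<notin> insert x X \<and> y < z) M"
      "filter_mset (\<lambda>z. z \<notin> Y \<and> z < y) ?M = filter_mset (\<lambda>z. z \<notin> Y \<and> z < y) M"
      "count ?M y = count M y"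
      by (auto simp: multiset_eq_iff)
    show "(count ?M y + size (filter_mset (\<lambda>z. z \<notin> X \<and> y < z) ?M) +
        size (filter_mset (\<lambda>z. z \<notin> Y \<and> z < y) ?M)) choose count ?M y =
      (count M y + size (filter_mset (\<lambda>z. z \<notin> insert x X \<and> y < z) M) +
        size (filter_mset (\<lambda>z. z \<notin> Y \<and> z < y) M)) choose count M y"
      unfolding eq ..
  qed
  moreover have "filter_mset (\<lambda>z. z \<notin> X) ?M = filter_mset (\<lambda>z. z \<notin> insert x X) M"
    by (auto simp: multiset_eq_iff)
  ultimately have IH: "card (descent_free_perms X Y ?M) =
    card (permutations_of_multiset (filter_mset (\<lambda>z. z \<notin> insert x X) M)) *
    (\<Prod>y\<in>X. (count M y + size (filter_mset (\<lambda>z. z \<notin> insert x X \<and> y < z) M) +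
        size (filter_mset (\<lambda>z. z \<notin> Y \<and> z < y) M)) choose count M y)"
    using insert.IH[of ?M] by (simp only:)
  show ?case
    by (simp only: * IH prod.insert[OF insert.hyps(1) xX] mult.assoc mult.commute mult.left_commute)
qed

section \<open>Words with bars\<close>

definition barred :: "nat set \<Rightarrow> nat set \<Rightarrow> nat list \<Rightarrow> nat \<Rightarrow> nat list set" where
  "barred X Y w r = {u. filter (\<lambda>y. y \<noteq> 0) u = w \<and> count_list u 0 = r \<and> descent_free X Y u}"

lemma des_Nil [simp]: "des X Y [] = 0" and des_single [simp]: "des X Y [p] = 0"
  by (simp_all add: des_def)

lemma des_Cons_Cons [simp]:
  "des X Y (p # c # w) = (if c < p \<and> p \<in> X \<and> c \<in> Y then 1 else 0) + des X Y (c # w)"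
proof -
  define D where "D w = {i. Suc i < length w \<and> w ! i > w ! Suc i \<and> w ! i \<in> X \<and> w ! Suc i \<in> Y}"
    for w :: "nat list"
  have fin: "finite (D w)" for w
    by (rule finite_subset[of _ "{..<length w}"]) (auto simp: D_def)
  have "D (p # c # w) = (if c < p \<and> p \<in> X \<and> c \<in> Y then {0} else {}) \<union> Suc ` D (c # w)"
    (is "?L = ?R")
  proof (rule set_eqI)
    fix i show "i \<in> ?L \<longleftrightarrow> i \<in> ?R" by (cases i) (auto simp: D_def)
  qed
  then have "card (D (p # c # w)) =
      (if c < p \<and> p \<in> X \<and> c \<in> Y then 1 else 0) + card (D (c # w))"
    using fin by (auto simp: card_image)
  then show ?thesis by (simp add: des_def D_def)
qed

text \<open>No letter lies below \<open>0\<close>, so no counted descent starts at a bar, even when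
  \<open>0\<close> is in \<open>X\<close>.\<close>

lemma descent_free_Cons_0 [simp]: "descent_free X Y (0 # u) \<longleftrightarrow> descent_free X Y (u :: nat list)"
  by (simp add: descent_free_Cons)

lemma barred_Nil: "barred X Y [] r = {replicate r 0}"
proof -
  have "u = replicate r 0" if "filter (\<lambda>y. y \<noteq> 0) u = []" "count_list u 0 = r" for u :: "nat list"
    using that by (induction u arbitrary: r) (auto split: if_splits)
  moreover have "count_list (replicate r (0::nat)) 0 = r \<and> descent_free X Y (replicate r 0)"
    by (induction r) auto
  ultimately show ?thesis by (auto simp: barred_def)
qed

text \<open>A descent at the front of \<open>c # w\<close> forces a bar between its two letters.\<close>

lemma barred_Cons:
  assumes "0 < c" "0 \<notin> set w" "0 \<notin> Y"
    and d_def: "d \<longleftrightarrow> w \<noteq> [] \<and> hd w < c \<and> c \<in> X \<and> hd w \<in> Y"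
  shows "barred X Y (c # w) r =
    (if r > 0 then Cons 0 ` barred X Y (c # w) (r - 1) else {}) \<union>
    (if d then if r > 0 then (\<lambda>u. c # 0 # u) ` barred X Y w (r - 1) else {}
     else Cons c ` barred X Y w r)"
    (is "?L = ?R")
proof (intro set_eqI iffI)
  fix u assume u: "u \<in> ?L"
  then obtain p v where uv: "u = p # v"
    by (cases u) (auto simp: barred_def)
  show "u \<in> ?R"
  proof (cases "p = 0")
    case True
    then show ?thesis using u uv by (auto simp: barred_def)
  next
    case False
    then have pc: "p = c" and v: "v \<in> barred X Y w r"
      using u uv by (auto simp: barred_def dest: descent_free_ConsD)
    show ?thesis
    proof (cases d)
      case False
      then show ?thesis using v pc uv by auto
    next
      case True
      then obtain b v' where "v = b # v'" using v by (cases v) (auto simp: barred_def d_def)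
      \<comment> \<open>If \<open>v\<close> started with \<open>hd w\<close> instead of a bar,
        \<open>c\<close> and \<open>hd w\<close> would form a counted descent.\<close>
      then have "v = 0 # v'"
        using True u uv v pc by (auto simp: barred_def d_def split: if_splits)
      then show ?thesis using True v pc uv by (auto simp: barred_def)
    qed
  qed
next
  fix u assume u: "u \<in> ?R"
  consider v where "r > 0" "u = 0 # v" "v \<in> barred X Y (c # w) (r - 1)"
    | v where "d" "r > 0" "u = c # 0 # v" "v \<in> barred X Y w (r - 1)"
    | v where "\<not> d" "u = c # v" "v \<in> barred X Y w r"
    using u by (auto split: if_splits)
  then show "u \<in> ?L"
  proof cases
    case 3
    \<comment> \<open>Either a bar follows \<open>c\<close>, and \<open>0\<close> is outside
      \<open>Y\<close>, or \<open>hd v\<close> is \<open>hd w\<close>, and the failure of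
      \<open>d\<close> excludes a counted descent.\<close>
    have "\<not> (hd v < c \<and> c \<in> X \<and> hd v \<in> Y)" if "v \<noteq> []"
    proof (cases "hd v = 0")
      case False
      then have "w \<noteq> []" "hd w = hd v" using 3 that by (cases v; auto simp: barred_def)+
      then show ?thesis using 3 by (auto simp: d_def)
    qed (use assms in auto)
    then show ?thesis using 3 assms by (auto simp: barred_def descent_free_Cons)
  qed (use assms in \<open>auto simp: barred_def\<close>)
qed

text \<open>Each counted descent claims one bar; the remaining \<open>r - des X Y w\<close> bars go
  freely into the \<open>length w + 1\<close> gaps. The two disjoint pieces of
  \<open>barred_Cons\<close> give Pascal's rule.\<close>

lemma card_barred:
  assumes "0 \<notin> set w" "0 \<notin> Y"
  shows "finite (barred X Y w r) \<and> card (barred X Y w r) =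
    (if des X Y w \<le> r then (length w + r - des X Y w) choose length w else 0)"
  using assms(1)
proof (induction w arbitrary: r)
  case Nil
  show ?case by (simp add: barred_Nil)
next
  case (Cons c w)
  define d where "d \<longleftrightarrow> w \<noteq> [] \<and> hd w < c \<and> c \<in> X \<and> hd w \<in> Y"
  have c: "0 < c" and w: "0 \<notin> set w" using Cons.prems by auto
  note IH = Cons.IH[OF w]
  note eq = barred_Cons[OF c w \<open>0 \<notin> Y\<close> d_def]
  have des: "des X Y (c # w) = (if d then 1 else 0) + des X Y w"
    by (cases w) (auto simp: d_def)
  have inj: "inj_on (\<lambda>u. c # 0 # u) A" for A by (auto simp: inj_on_def)
  show ?case
  proof (induction r)
    case 0
    show ?case using IH[of 0] eq[of 0] des by (auto simp: card_image)
  next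
    case (Suc r)
    have disj: "Cons 0 ` A \<inter> Cons c ` B = {}" "Cons 0 ` A \<inter> (\<lambda>u. c # 0 # u) ` B = {}" for A B
      using c by auto
    show ?case
    proof (cases d)
      case True
      have "card (barred X Y (c # w) (Suc r)) = card (barred X Y (c # w) r) + card (barred X Y w r)"
        and "finite (barred X Y (c # w) (Suc r))"
        using True eq[of "Suc r"] Suc IH[of r] disj
        by (simp_all add: card_Un_disjoint card_image inj)
      then show ?thesis using True des Suc IH[of r]
        by (auto simp: Suc_diff_le not_le le_Suc_eq)
    next
      case False
      have "card (barred X Y (c # w) (Suc r)) = card (barred X Y (c # w) r) + card (barred X Y w (Suc r))"
        and "finite (barred X Y (c # w) (Suc r))"
        using False eq[of "Suc r"] Suc IH[of "Suc r"] disj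
        by (simp_all add: card_Un_disjoint card_image)
      then show ?thesis using False des Suc IH[of "Suc r"]
        by (auto simp: Suc_diff_le not_le le_Suc_eq)
    qed
  qed
qed


section \<open>The letters of a composition, with and without bars\<close>

definition content_mset :: "nat list \<Rightarrow> nat multiset" where
  "content_mset \<rho> = (\<Sum>i = 1..length \<rho>. replicate_mset (part \<rho> i) i)"

lemma filter_mset_replicate_mset:
  "filter_mset Q (replicate_mset k x) = (if Q x then replicate_mset k x else {#})"
  by (induction k) auto

lemma count_sum_replicate_mset:
  "finite A \<Longrightarrow> count (\<Sum>i\<in>A. replicate_mset (f i) i) x = (if x \<in> A then f x else 0)"
  by (induction A rule: finite_induct) auto

lemma size_filter_sum_replicate_mset:
  "finite A \<Longrightarrow> size (filter_mset Q (\<Sum>i\<in>A. replicate_mset (f i) i)) = (\<Sum>i\<in>{i \<in> A. Q i}. f i)"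
proof (induction A rule: finite_induct)
  case (insert x A)
  have "{i \<in> insert x A. Q i} = (if Q x then insert x {i \<in> A. Q i} else {i \<in> A. Q i})" by auto
  then show ?case using insert by (auto simp: filter_mset_replicate_mset)
qed simp

lemma count_content_mset:
  "count (content_mset \<rho>) x = (if x \<in> {1..length \<rho>} then part \<rho> x else 0)"
  unfolding content_mset_def by (subst count_sum_replicate_mset) auto

lemma size_filter_content_mset:
  "size (filter_mset Q (content_mset \<rho>)) = (\<Sum>i\<in>{i \<in> {1..length \<rho>}. Q i}. part \<rho> i)"
  unfolding content_mset_def by (rule size_filter_sum_replicate_mset) simp

lemma sum_list_eq_sum_part: "sum_list \<rho> = (\<Sum>i = 1..length \<rho>. part \<rho> i)"
  unfolding sum_list_sum_nth part_def atLeast0LessThan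
  by (rule sum.reindex_bij_witness[of _ "\<lambda>i. i - 1" Suc]) auto

lemma size_content_mset: "size (content_mset \<rho>) = sum_list \<rho>"
  using size_filter_content_mset[of "\<lambda>_. True" \<rho>]
  by (simp add: sum_list_eq_sum_part flip: atLeastAtMost_def atLeastAtMost_iff)

lemma set_content_mset: "set_mset (content_mset \<rho>) \<subseteq> {1..length \<rho>}"
  by (auto simp: set_mset_def count_content_mset split: if_splits)

lemma mset_words: "w \<in> words \<rho> \<longleftrightarrow> mset w = content_mset \<rho>"
  by (simp add: words_def content_mset_def permutations_of_multiset_def)

lemma set_words: "w \<in> words \<rho> \<Longrightarrow> set w \<subseteq> {1..length \<rho>}"
  using set_content_mset by (metis mset_words set_mset_mset)

lemma length_words: "w \<in> words \<rho> \<Longrightarrow> length w = sum_list \<rho>"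
  by (metis mset_words size_mset size_content_mset)

lemma finite_words [simp]: "finite (words \<rho>)"
  by (simp add: words_def)

lemma des_cong:
  assumes "X \<inter> set w = X' \<inter> set w" "Y \<inter> set w = Y' \<inter> set w"
  shows "des X Y w = des X' Y' w"
proof -
  have "v \<in> X \<longleftrightarrow> v \<in> X'" "v \<in> Y \<longleftrightarrow> v \<in> Y'" if "v \<in> set w" for v
    using assms that by auto
  then show ?thesis
    unfolding des_def by (intro arg_cong[of _ _ card]) (auto dest: Suc_lessD)
qed

text \<open>Erasing the bars from a descent-free arrangement of the enlarged multiset leaves a word,
  and the fibre over \<open>w\<close> is \<open>barred X Y w r\<close>.\<close>

lemma sum_card_barred:
  "(\<Sum>w\<in>words \<rho>. card (barred X Y w r)) =
    card (descent_free_perms X Y (content_mset \<rho> + replicate_mset r 0))"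
proof -
  let ?A = "descent_free_perms X Y (content_mset \<rho> + replicate_mset r 0)"
    and ?f = "filter (\<lambda>y::nat. y \<noteq> 0)"
  have c0: "count (content_mset \<rho>) 0 = 0" by (simp add: count_content_mset)
  have M: "mset u = content_mset \<rho> + replicate_mset r 0 \<longleftrightarrow>
      filter_mset (\<lambda>y. y \<noteq> 0) (mset u) = content_mset \<rho> \<and> count (mset u) 0 = r" for u
    using c0 by (auto simp: multiset_eq_iff)
  have A: "u \<in> ?A \<longleftrightarrow> ?f u \<in> words \<rho> \<and> count_list u 0 = r \<and> descent_free X Y u" for u
    using M[of u]
    by (auto simp: descent_free_perms_def permutations_of_multiset_def count_list_eq_count mset_words)
  have "finite ?A" by (simp add: descent_free_perms_def)
  then have "card ?A = (\<Sum>w\<in>words \<rho>. card {u \<in> ?A. ?f u = w})"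
    using A by (intro card_eq_sum_fibres finite_words) blast+
  also have "\<dots> = (\<Sum>w\<in>words \<rho>. card (barred X Y w r))"
  proof (intro sum.cong refl arg_cong[of _ _ card])
    fix w assume "w \<in> words \<rho>"
    then show "{u \<in> ?A. ?f u = w} = barred X Y w r"
      using A by (auto simp: barred_def)
  qed
  finally show ?thesis ..
qed

text \<open>The \<open>r\<close> bars occupy any \<open>r\<close> of the \<open>a + r\<close>
  positions, and the other letters are arranged independently.\<close>

lemma card_permutations_content_mset:
  assumes V: "V = {1..length \<rho>} - X" and a: "a = (\<Sum>v\<in>V. part \<rho> v)"
  shows "card (permutations_of_multiset (filter_mset (\<lambda>z. z \<notin> X) (content_mset \<rho>) + replicate_mset r 0)) =
    multinomial a (part \<rho>) V * ((a + r) choose r)"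
proof -
  let ?N = "filter_mset (\<lambda>z. z \<notin> X) (content_mset \<rho>)"
  let ?\<Pi> = "\<Prod>v\<in>V. fact (part \<rho> v) :: nat"
  have size: "size ?N = a"
    unfolding size_filter_content_mset a V by (intro sum.cong) auto
  \<comment> \<open>Used twice: \<open>k = 0\<close> shows that the division in
    \<open>multinomial\<close> is exact, and \<open>k = r\<close> gives the count.\<close>
  have *: "card (permutations_of_multiset (?N + replicate_mset k 0)) * (fact k * ?\<Pi>) = fact (a + k)" for k
  proof -
    let ?M = "?N + replicate_mset k 0"
    \<comment> \<open>Letters of multiplicity zero contribute \<open>fact 0 = 1\<close>, so the
      product may run over \<open>insert 0 V\<close> even if \<open>k\<close> or some part is
      zero.\<close>
    have "(\<Prod>x\<in>set_mset ?M. fact (count ?M x) :: nat) = (\<Prod>x\<in>insert 0 V. fact (count ?M x))"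
    proof (rule prod.mono_neutral_left)
      show "set_mset ?M \<subseteq> insert 0 V"
        using set_content_mset[of \<rho>] V by (auto split: if_splits)
      show "\<forall>x\<in>insert 0 V - set_mset ?M. fact (count ?M x) = (1 :: nat)"
        by (metis DiffD2 fact_0 not_in_iff)
    qed (simp add: V)
    also have "\<dots> = fact (count ?M 0) * (\<Prod>x\<in>V. fact (count ?M x))"
      by (subst prod.insert) (auto simp: V)
    also have "(\<Prod>x\<in>V. fact (count ?M x)) = ?\<Pi>"
      by (intro prod.cong refl) (auto simp: V count_content_mset)
    also have "count ?M 0 = k"
      by (simp add: count_content_mset)
    finally show ?thesis
      using card_permutations_of_multiset_aux[of ?M] size by simp
  qed
  have pos: "0 < ?\<Pi>" by (simp add: prod_pos)
  have "?\<Pi> dvd fact a"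
    using *[of 0] by (metis add.right_neutral dvd_triv_right fact_0 mult_1)
  then have mult: "multinomial a (part \<rho>) V * ?\<Pi> = fact a"
    by (simp add: multinomial_def)
  have "card (permutations_of_multiset (?N + replicate_mset r 0)) * (fact r * ?\<Pi>) =
      fact r * fact a * ((a + r) choose r)"
    using *[of r] binomial_fact_lemma[of r "a + r"] by simp
  also have "\<dots> = (multinomial a (part \<rho>) V * ((a + r) choose r)) * (fact r * ?\<Pi>)"
    by (simp add: mult[symmetric] mult_ac)
  finally show ?thesis using pos by simp
qed

section \<open>Inverting the count of barred words\<close>

text \<open>The last factor is the coefficient of \<open>t^r\<close> in
  \<open>t^d * (1 - t)^(-(n+1))\<close>, and the signed binomials are coefficients of
  \<open>(1 - t)^(n+1)\<close>; the sum is the coefficient of \<open>t^s\<close> in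
  \<open>t^d\<close>. The explicit \<open>0\<close> for \<open>r < d\<close> matters when
  \<open>n = 0\<close>, where truncated subtraction would yield \<open>1\<close>.\<close>

lemma alternating_binomial_convolution:
  fixes n d s :: nat
  shows "(\<Sum>r = 0..s. (-1) ^ (s - r) * int ((n + 1) choose (s - r)) *
      int (if d \<le> r then (n + r - d) choose n else 0)) = (if d = s then 1 else 0)"
    (is "?L = _")
proof (cases "d \<le> s")
  case False
  then show ?thesis by auto
next
  case True
  define q where "q = s - d"
  have s: "s = q + d" using True by (simp add: q_def)
  let ?g = "\<lambda>r. (-1) ^ (s - r) * int ((n + 1) choose (s - r)) *
      int (if d \<le> r then (n + r - d) choose n else 0)"
  have "?L = (\<Sum>r = d..s. ?g r)"
    by (rule sum.mono_neutral_right) auto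
  also have "\<dots> = (\<Sum>j = 0..q. ?g (j + d))"
    unfolding s using sum.shift_bounds_cl_nat_ivl[of ?g 0 d q] s by simp
  also have "\<dots> = (\<Sum>j = 0..q. (-1) ^ (q - j) * int ((n + 1) choose (q - j)) * int ((n + j) choose n))"
    by (intro sum.cong refl) (simp add: s)
  finally have L: "?L = \<dots>" .
  \<comment> \<open>Over the reals, \<open>(n + j) choose n\<close> is up to sign a binomial with
    upper index \<open>-(n + 1)\<close>. Vandermonde's identity then adds the upper indices to
    \<open>0\<close>, and \<open>0 gchoose q\<close> vanishes unless \<open>q = 0\<close>, that is,
    \<open>d = s\<close>.\<close>
  have "real_of_int ?L =
      (\<Sum>j = 0..q. (-1) ^ q * ((- real (n + 1) gchoose j) * (real (n + 1) gchoose (q - j))))"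
    unfolding L of_int_sum
  proof (intro sum.cong refl)
    fix j assume "j \<in> {0..q}"
    then have "(-1) ^ (q - j) = (-1) ^ q * (-1 :: real) ^ j"
      by (simp add: minus_one_power_iff)
    moreover have "- real (n + 1) gchoose j = (-1) ^ j * real ((n + j) choose n)"
      using gbinomial_minus[of "real (n + 1)" j] binomial_symmetric[of n "n + j"]
      by (simp add: binomial_gbinomial add_ac)
    ultimately show "real_of_int ((-1) ^ (q - j) * int ((n + 1) choose (q - j)) * int ((n + j) choose n)) =
        (-1) ^ q * ((- real (n + 1) gchoose j) * (real (n + 1) gchoose (q - j)))"
      by (simp add: binomial_gbinomial flip: power_mult_distrib)
  qed
  also have "\<dots> = (-1) ^ q * ((- real (n + 1) + real (n + 1)) gchoose q)"
    by (simp only: sum_distrib_left[symmetric] gbinomial_Vandermonde)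
  also have "\<dots> = (if d = s then 1 else 0)"
    by (cases q) (auto simp: s)
  finally have "real_of_int ?L = real_of_int (if d = s then 1 else 0)" by simp
  then show ?thesis by (simp only: of_int_eq_iff)
qed

theorem theorem5p1:
  fixes X Y :: "nat set" and \<rho> :: "nat list" and m n s a :: nat
  assumes "composition n \<rho>"
    and "m = length \<rho>"
    and "a = (\<Sum>v \<in> {1..m} - X. part \<rho> v)"
  shows "int (P X Y \<rho> s) =
    int (multinomial a (part \<rho>) ({1..m} - X)) *
    (\<Sum>r = 0..s. (-1) ^ (s - r) * int ((a + r) choose r) * int ((n + 1) choose (s - r)) *
      (\<Prod>x \<in> X \<inter> {1..m}. int ((part \<rho> x + r + \<alpha> X \<rho> x + \<beta> Y \<rho> x) choose part \<rho> x)))"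
proof -
  \<comment> \<open>The words use only letters from \<open>{1..m}\<close>, so this change does not
    affect their counted descents. It makes \<open>X\<close> finite and puts the bar
    \<open>0\<close> outside both sets.\<close>
  let ?X = "X \<inter> {1..m}" and ?Y = "Y - {0}"
  define F where "F r = multinomial a (part \<rho>) ({1..m} - X) * ((a + r) choose r) *
    (\<Prod>x \<in> ?X. (part \<rho> x + r + \<alpha> X \<rho> x + \<beta> Y \<rho> x) choose part \<rho> x)" for r
  have n: "n = sum_list \<rho>" using assms(1) by (simp add: composition_def)
  \<comment> \<open>Both sides count barred words with \<open>r\<close> bars: the left groups them
    by the underlying word, the right is the product formula for descent-free words.\<close>
  have F: "(\<Sum>w\<in>words \<rho>. if des X Y w \<le> r then (n + r - des X Y w) choose n else 0) = F r" for r
  proof -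
    let ?M = "content_mset \<rho> + replicate_mset r 0"
    have "(\<Sum>w\<in>words \<rho>. if des X Y w \<le> r then (n + r - des X Y w) choose n else 0) =
        (\<Sum>w\<in>words \<rho>. card (barred ?X ?Y w r))"
    proof (intro sum.cong refl)
      fix w assume w: "w \<in> words \<rho>"
      have "des ?X ?Y w = des X Y w"
        using set_words[OF w] assms(2) by (intro des_cong) auto
      moreover have "0 \<notin> set w" using set_words[OF w] by auto
      ultimately show "(if des X Y w \<le> r then (n + r - des X Y w) choose n else 0) = card (barred ?X ?Y w r)"
        using card_barred[of w ?Y ?X r] length_words[OF w] n by simp
    qed
    also have "\<dots> = card (descent_free_perms ?X ?Y ?M)"
      by (rule sum_card_barred)
    also have "\<dots> = card (permutations_of_multiset (filter_mset (\<lambda>z. z \<notin> ?X) ?M)) *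
      (\<Prod>x\<in>?X. (count ?M x + size (filter_mset (\<lambda>z. z \<notin> ?X \<and> x < z) ?M) +
          size (filter_mset (\<lambda>z. z \<notin> ?Y \<and> z < x) ?M)) choose count ?M x)"
      by (rule card_descent_free_perms) simp
    also have "filter_mset (\<lambda>z. z \<notin> ?X) ?M =
        filter_mset (\<lambda>z. z \<notin> X) (content_mset \<rho>) + replicate_mset r 0"
      using assms(2) by (auto simp: multiset_eq_iff count_content_mset)
    also have "card (permutations_of_multiset \<dots>) =
        multinomial a (part \<rho>) ({1..m} - X) * ((a + r) choose r)"
      using assms by (intro card_permutations_content_mset) auto
    also have "(\<Prod>x\<in>?X. (count ?M x + size (filter_mset (\<lambda>z. z \<notin> ?X \<and> x < z) ?M) +
          size (filter_mset (\<lambda>z. z \<notin> ?Y \<and> z < x) ?M)) choose count ?M x) =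
        (\<Prod>x \<in> ?X. (part \<rho> x + r + \<alpha> X \<rho> x + \<beta> Y \<rho> x) choose part \<rho> x)"
    proof (intro prod.cong refl)
      fix x assume x: "x \<in> ?X"
      have c: "count ?M x = part \<rho> x" using x assms(2) by (auto simp: count_content_mset)
      \<comment> \<open>The bars lie below \<open>x\<close> and outside \<open>?Y\<close>, so they
        add \<open>r\<close> to the \<beta> term and nothing to the \<alpha> term.\<close>
      have "size (filter_mset (\<lambda>z. z \<notin> ?X \<and> x < z) ?M) = \<alpha> X \<rho> x"
        using x assms(2)
        by (auto simp: size_filter_content_mset \<alpha>_def filter_mset_replicate_mset intro!: sum.cong)
      moreover have "size (filter_mset (\<lambda>z. z \<notin> ?Y \<and> z < x) ?M) = r + \<beta> Y \<rho> x"
        using x assms(2)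
        by (auto simp: size_filter_content_mset \<beta>_def filter_mset_replicate_mset intro!: sum.cong)
      ultimately show "(count ?M x + size (filter_mset (\<lambda>z. z \<notin> ?X \<and> x < z) ?M) +
          size (filter_mset (\<lambda>z. z \<notin> ?Y \<and> z < x) ?M)) choose count ?M x =
        (part \<rho> x + r + \<alpha> X \<rho> x + \<beta> Y \<rho> x) choose part \<rho> x"
        using c by (simp add: add_ac)
    qed
    finally show ?thesis by (simp add: F_def)
  qed
  have "int (P X Y \<rho> s) = (\<Sum>w\<in>words \<rho>. if des X Y w = s then 1 else 0)"
    by (simp add: P_def sum.If_cases Int_def)
  \<comment> \<open>The indicator of \<open>des X Y w = s\<close> is expanded as the alternating
    sum; after exchanging the sums, the inner one is \<open>F r\<close>.\<close>
  also have "\<dots> = (\<Sum>w\<in>words \<rho>. \<Sum>r = 0..s. (-1) ^ (s - r) * int ((n + 1) choose (s - r)) *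
      int (if des X Y w \<le> r then (n + r - des X Y w) choose n else 0))"
    by (simp only: alternating_binomial_convolution)
  also have "\<dots> = (\<Sum>r = 0..s. (-1) ^ (s - r) * int ((n + 1) choose (s - r)) * int (F r))"
    by (subst sum.swap) (simp only: F[symmetric] of_nat_sum sum_distrib_left)
  also have "\<dots> = int (multinomial a (part \<rho>) ({1..m} - X)) *
    (\<Sum>r = 0..s. (-1) ^ (s - r) * int ((a + r) choose r) * int ((n + 1) choose (s - r)) *
      (\<Prod>x \<in> ?X. int ((part \<rho> x + r + \<alpha> X \<rho> x + \<beta> Y \<rho> x) choose part \<rho> x)))"
    by (simp add: F_def sum_distrib_left mult_ac)
  finally show ?thesis .
qed

end
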